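(* Let $n\ge 3$ be an integer and let $Fan_n$ be the fan graph, obtained from the wheel graph $W_n$ with $n$ rim vertices by removing one rim edge. Then $\mathrm{mpd}(Fan_n)=\infty$.
   Context: The wheel graph $W_n$ is obtained from a cycle on $n$ vertices (the rim) by adding one new vertex (the hub) adjacent to all rim vertices; so $Fan_n$ is a path on $n$ vertices together with one extra vertex adjacent to all vertices of the path. $d(u,v)$ denotes the shortest-path distance. Let $G$ be a connected graph and let $\Pi=\{S_1,\dots,S_t\}$ be a partition of $V(G)$ into nonempty parts. For $v\in V(G)$ put $d(v,S_i)=\min\{d(v,x):x\in S_i\}$. The multiset partition representation of $v$ with respect to $\Pi$ is the multiset $r_{mp}(v\mid\Pi)=\{d(v,S_1),\dots,d(v,S_t)\}$ (order ignored, multiplicities kept). $\Pi$ is a resolving multiset partition if $r_{mp}(u\mid\Pi)\ne r_{mp}(v\mid\Pi)$ for all distinct $u,v\in V(G)$. The multiset partition dimension $\mathrm{mpd}(G)$ is the minimum number $t$ of parts of a resolving multiset partition of $G$, and $\mathrm{mpd}(G)=\infty$ if none exists. *)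

theory Defs
  imports
    "Graph_Theory.Graph_Theory"
    "HOL-Library.Disjoint_Sets"
    "HOL-Library.Multiset"
    "HOL-Library.Extended_Nat"
begin

text \<open>
  Simple graphs are values of type \<^typ>\<open>'a pair_pre_digraph\<close> satisfying \<^locale>\<open>pair_graph\<close>
  (finite, symmetric, loop-free); an edge is a pair of opposite arcs.
\<close>

definition graph_dist :: "'a pair_pre_digraph \<Rightarrow> 'a \<Rightarrow> 'a \<Rightarrow> ereal" where
  "graph_dist G u v = wf_digraph.\<mu> (with_proj G) (\<lambda>_. 1) u v"

text \<open>The following definitions are meant for finite connected \<open>G\<close>; parts are then finite
  and nonempty, so that \<^const>\<open>Min\<close> and \<^const>\<open>mset_set\<close> have their usual meaning.\<close>

definition part_dist :: "'a pair_pre_digraph \<Rightarrow> 'a \<Rightarrow> 'a set \<Rightarrow> ereal" where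
  "part_dist G v S = Min (graph_dist G v ` S)"

definition mp_representation :: "'a pair_pre_digraph \<Rightarrow> 'a set set \<Rightarrow> 'a \<Rightarrow> ereal multiset" where
  "mp_representation G P v = image_mset (part_dist G v) (mset_set P)"

definition resolving_multiset_partition :: "'a pair_pre_digraph \<Rightarrow> 'a set set \<Rightarrow> bool" where
  "resolving_multiset_partition G P \<longleftrightarrow>
     partition_on (pverts G) P \<and>
     (\<forall>u\<in>pverts G. \<forall>v\<in>pverts G. u \<noteq> v \<longrightarrow> mp_representation G P u \<noteq> mp_representation G P v)"

text \<open>In \<^typ>\<open>enat\<close> the infimum of a nonempty set is its minimum, and that of the empty set is \<open>\<infinity>\<close>.\<close>

definition mpd :: "'a pair_pre_digraph \<Rightarrow> enat" where
  "mpd G = (INF P\<in>{P. resolving_multiset_partition G P}. enat (card P))"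

datatype wheel_vertex = Hub | Rim nat

definition wheel :: "nat \<Rightarrow> wheel_vertex pair_pre_digraph" where
  "wheel n = \<lparr> pverts = insert Hub (Rim ` {..<n}),
     parcs = {(Hub, Rim i) | i. i < n} \<union> {(Rim i, Hub) | i. i < n} \<union>
       {(Rim i, Rim j) | i j. i < n \<and> j < n \<and> (j = Suc i mod n \<or> i = Suc j mod n)} \<rparr>"

text \<open>The parameter \<open>k < n\<close> selects the rim edge to be removed, namely the one joining rim
  vertices \<open>k\<close> and \<open>k + 1\<close> modulo \<open>n\<close>; all choices give isomorphic graphs.\<close>

definition fan :: "nat \<Rightarrow> nat \<Rightarrow> wheel_vertex pair_pre_digraph" where
  "fan n k = (wheel n) \<lparr> parcs := parcs (wheel n) -
     {(Rim k, Rim (Suc k mod n)), (Rim (Suc k mod n), Rim k)} \<rparr>"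

lemma pverts_fan: "pverts (fan n k) = insert Hub (Rim ` {..<n})"
  by (simp add: fan_def wheel_def)

lemma parcs_fan:
  "parcs (fan n k) = {(Hub, Rim i) | i. i < n} \<union> {(Rim i, Hub) | i. i < n} \<union>
     ({(Rim i, Rim j) | i j. i < n \<and> j < n \<and> (j = Suc i mod n \<or> i = Suc j mod n)} -
      {(Rim k, Rim (Suc k mod n)), (Rim (Suc k mod n), Rim k)})"
  by (auto simp: fan_def wheel_def)

lemma pair_graph_fan:
  assumes "n \<ge> 3"
  shows "pair_graph (fan n k)"
proof
  fix e assume e: "e \<in> parcs (fan n k)"
  then show "fst e \<in> pverts (fan n k)" "snd e \<in> pverts (fan n k)"
    by (auto simp: pverts_fan parcs_fan)
  have "\<not> (i < n \<and> Suc i mod n = i)" for i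
    using assms by (cases "Suc i = n") auto
  then show "fst e \<noteq> snd e"
    using e unfolding parcs_fan by fastforce
next
  show "finite (pverts (fan n k))"
    by (simp add: pverts_fan)
  have "parcs (fan n k) \<subseteq> pverts (fan n k) \<times> pverts (fan n k)"
    by (auto simp: pverts_fan parcs_fan)
  then show "finite (parcs (fan n k))"
    by (rule finite_subset) (simp add: pverts_fan)
  show "symmetric (with_proj (fan n k))"
    by (auto simp: symmetric_def sym_def parcs_fan)
qed

lemma connected_fan:
  assumes "n \<ge> 3"
  shows "connected (with_proj (fan n k))"
proof -
  interpret pair_graph "fan n k" using assms by (rule pair_graph_fan)
  have hub: "Hub \<rightarrow>\<^sup>*\<^bsub>fan n k\<^esub> v" "v \<rightarrow>\<^sup>*\<^bsub>fan n k\<^esub> Hub" if "v \<in> pverts (fan n k)" for v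
    using that
    by (cases "v = Hub"; auto simp: pverts_fan parcs_fan intro: reachable_adjI reachable_refl)+
  then have "u \<rightarrow>\<^sup>*\<^bsub>fan n k\<^esub> v" if "u \<in> pverts (fan n k)" "v \<in> pverts (fan n k)" for u v
    using that by (blast intro: reachable_trans)
  then show ?thesis
    unfolding connected_def strongly_connected_def
    by (auto simp: pverts_fan intro!: reachable_mk_symmetricI)
qed

lemma rim_arcs_fan_path:
  assumes "n \<ge> 3"
  shows "(Rim i, Rim j) \<in> parcs (fan n (n - 1)) \<longleftrightarrow> i < n \<and> j < n \<and> (j = Suc i \<or> i = Suc j)"
  using assms by (auto simp: parcs_fan mod_Suc split: if_splits)

end

theory Submission
  imports Defs
begin

text \<open>
  The hub is adjacent to all other vertices, so all distances are at most 2 and the representation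
  of \<open>v\<close> is determined by the number of parts at distance 1 from \<open>v\<close>. A rim vertex has at most three
  neighbours, so this number is at most 3 on the rim, and the pigeonhole principle gives \<open>n \<le> 4\<close>. For
  \<open>n = 4\<close> the value 0 is attained on the rim, which forces some rim vertex into the part of the hub;
  then there are at most four parts, so all five vertices take values in \<open>{0..3}\<close>. For \<open>n = 3\<close>
  the middle vertex of the path is adjacent to all other vertices, like the hub, and these two
  are not distinguished.
\<close>

section \<open>Graphs with a vertex adjacent to all others\<close>

definition universal_vertex :: "'a pair_pre_digraph \<Rightarrow> 'a \<Rightarrow> bool" where
  "universal_vertex G h \<longleftrightarrow> h \<in> pverts G \<and> (\<forall>v\<in>pverts G - {h}. (h, v) \<in> parcs G)"

text \<open>The condition \<open>v \<notin> S\<close> discards the part of \<open>v\<close> itself,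
  whose distance is 0 even if it contains neighbours of \<open>v\<close>. When \<open>P\<close>
  partitions the vertices, what remains are the parts at distance exactly 1.\<close>

definition adjacent_parts :: "'a pair_pre_digraph \<Rightarrow> 'a set set \<Rightarrow> 'a \<Rightarrow> 'a set set" where
  "adjacent_parts G P v = {S \<in> P. v \<notin> S \<and> (\<exists>x\<in>S. (v, x) \<in> parcs G)}"

lemma (in wf_digraph) awalk_cost_one: "awalk_cost (\<lambda>_. 1) p = real (length p)"
  by (simp add: awalk_cost_def sum_list_triv)

lemma (in pair_graph) graph_dist_le_length:
  assumes "awalk u p v"
  shows "graph_dist G u v \<le> ereal (real (length p))"
  unfolding graph_dist_def
  using min_cost_le_walk_cost[OF assms, of "\<lambda>_. 1"] by (simp add: awalk_cost_one)

lemma (in pair_graph) graph_dist_geI: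
  assumes "\<And>p. awalk u p v \<Longrightarrow> d \<le> ereal (real (length p))"
  shows "d \<le> graph_dist G u v"
  unfolding graph_dist_def \<mu>_def
  using assms by (auto intro!: INF_greatest simp: awalk_cost_one)

text \<open>Distinct non-adjacent vertices both differ from \<open>h\<close>, so the walk through
  \<open>h\<close> has length 2, and no walk of length 0 or 1 joins them.\<close>

lemma (in pair_graph) graph_dist_universal_vertex:
  assumes h: "universal_vertex G h" and u: "u \<in> pverts G" and v: "v \<in> pverts G"
  shows "graph_dist G u v = (if u = v then 0 else if (u, v) \<in> parcs G then 1 else 2)"
proof -
  have hv: "(h, w) \<in> parcs G" "(w, h) \<in> parcs G" if "w \<in> pverts G" "w \<noteq> h" for w
    using that h arcs_symmetric[of h w] by (auto simp: universal_vertex_def)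
  consider "u = v" | "u \<noteq> v" "(u, v) \<in> parcs G" | "u \<noteq> v" "(u, v) \<notin> parcs G" by blast
  then show ?thesis
  proof cases
    case 1
    have "awalk u [] u" using u by (simp add: awalk_Nil_iff)
    from graph_dist_le_length[OF this] have "graph_dist G u v \<le> 0"
      using 1 by (simp add: zero_ereal_def)
    moreover have "0 \<le> graph_dist G u v" by (rule graph_dist_geI) simp
    ultimately show ?thesis using 1 by simp
  next
    case 2
    have "awalk u [(u, v)] v" using 2 u v by (simp add: awalk_simps)
    from graph_dist_le_length[OF this] have "graph_dist G u v \<le> 1"
      by (simp add: one_ereal_def)
    moreover have "1 \<le> graph_dist G u v"
    proof (rule graph_dist_geI)
      fix p assume "awalk u p v"
      then show "1 \<le> ereal (real (length p))"
        using 2 by (cases p) (auto simp: awalk_simps one_ereal_def)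
    qed
    ultimately show ?thesis using 2 by simp
  next
    case 3
    have "u \<noteq> h" "v \<noteq> h" using 3 hv u v by auto
    then have "awalk u [(u, h), (h, v)] v" using hv u v by (simp add: awalk_simps)
    from graph_dist_le_length[OF this] have "graph_dist G u v \<le> 2"
      by simp
    moreover have "2 \<le> graph_dist G u v"
    proof (rule graph_dist_geI)
      fix p assume p: "awalk u p v"
      have "length p \<ge> 2"
      proof (rule ccontr)
        assume "\<not> length p \<ge> 2"
        then have "p = [] \<or> (\<exists>e. p = [e])" by (cases p; cases "tl p") auto
        then show False using p 3 by (auto simp: awalk_simps)
      qed
      then show "2 \<le> ereal (real (length p))" by simp
    qed
    ultimately show ?thesis using 3 by simp
  qed
qed

lemma (in pair_graph) part_dist_universal_vertex:
  assumes h: "universal_vertex G h" and v: "v \<in> pverts G"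
    and S: "S \<subseteq> pverts G" "S \<noteq> {}"
  shows "part_dist G v S = (if v \<in> S then 0 else if \<exists>x\<in>S. (v, x) \<in> parcs G then 1 else 2)"
proof -
  have fin: "finite S" using S finite_subset pair_finite_verts by blast
  have img: "graph_dist G v ` S =
      (\<lambda>x. if v = x then 0 else if (v, x) \<in> parcs G then 1 else 2) ` S"
    using S by (intro image_cong refl graph_dist_universal_vertex[OF h v]) auto
  show ?thesis
    unfolding part_dist_def img
    by (rule Min_eqI) (use fin S in \<open>auto simp: image_iff split: if_splits\<close>)
qed

text \<open>The part of \<open>v\<close> gives the only 0, and every other part is at distance 1 or
  2. As \<open>card P\<close> is the same for all vertices, a single number encodes the whole
  representation.\<close>

lemma (in pair_graph) mp_representation_universal_vertex:
  assumes h: "universal_vertex G h" and P: "partition_on (pverts G) P" and v: "v \<in> pverts G"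
  shows "mp_representation G P v = add_mset 0
     (replicate_mset (card (adjacent_parts G P v)) 1 +
      replicate_mset (card P - 1 - card (adjacent_parts G P v)) 2)"
proof -
  have fin: "finite P" using finite_elements[OF pair_finite_verts P] .
  obtain S0 where S0: "S0 \<in> P" "v \<in> S0" using P v by (auto simp: partition_on_def)
  have uniq: "S = S0" if "S \<in> P" "v \<in> S" for S
    using that S0 P by (auto simp: partition_on_def disjoint_def)
  define A where "A = adjacent_parts G P v"
  \<comment> \<open>\<open>B\<close> collects the parts at distance 2.\<close>
  define B where "B = P - {S0} - A"
  have A: "A \<subseteq> P - {S0}" using S0 by (auto simp: A_def adjacent_parts_def)
  have finAB: "finite A" "finite B" using A fin by (auto simp: B_def intro: finite_subset)
  have cB: "card B = card P - 1 - card A"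
    using A fin finAB S0 by (simp add: B_def card_Diff_subset)
  have split: "mset_set P = add_mset S0 (mset_set A + mset_set B)"
  proof -
    have "P = insert S0 (A \<union> B)" "S0 \<notin> A \<union> B" "A \<inter> B = {}"
      using S0 A by (auto simp: B_def)
    then show ?thesis using finAB by (simp add: mset_set_Union)
  qed
  have pd: "part_dist G v S = (if v \<in> S then 0 else if \<exists>x\<in>S. (v, x) \<in> parcs G then 1 else 2)"
    if "S \<in> P" for S
    using that P by (intro part_dist_universal_vertex[OF h v]) (auto simp: partition_on_def)
  have "part_dist G v S0 = 0" using pd S0 by simp
  moreover have "image_mset (part_dist G v) (mset_set A) = image_mset (\<lambda>_. 1) (mset_set A)"
    using finAB by (intro image_mset_cong) (auto simp: pd A_def adjacent_parts_def)
  moreover have "image_mset (part_dist G v) (mset_set B) = image_mset (\<lambda>_. 2) (mset_set B)"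
    using finAB uniq by (intro image_mset_cong) (auto simp: pd B_def A_def adjacent_parts_def)
  ultimately show ?thesis
    unfolding mp_representation_def split
    by (simp add: image_mset_const_eq cB flip: A_def)
qed

text \<open>This turns resolvability into a counting condition, to which the pigeonhole principle
  applies.\<close>

lemma (in pair_graph) inj_on_card_adjacent_parts:
  assumes "universal_vertex G h" and "resolving_multiset_partition G P"
  shows "inj_on (\<lambda>v. card (adjacent_parts G P v)) (pverts G)"
proof (rule inj_onI, rule ccontr)
  fix u v assume uv: "u \<in> pverts G" "v \<in> pverts G" "u \<noteq> v"
    and eq: "card (adjacent_parts G P u) = card (adjacent_parts G P v)"
  have "partition_on (pverts G) P"
    using assms(2) by (simp add: resolving_multiset_partition_def)
  then have "mp_representation G P u = mp_representation G P v"
    using uv eq by (simp add: mp_representation_universal_vertex[OF assms(1)])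
  then show False using assms(2) uv by (auto simp: resolving_multiset_partition_def)
qed

text \<open>Every part other than that of \<open>h\<close> is nonempty, and all its elements are
  neighbours of \<open>h\<close>.\<close>

lemma card_adjacent_parts_universal_vertex:
  assumes h: "universal_vertex G h" and P: "partition_on (pverts G) P"
  shows "card (adjacent_parts G P h) = card P - 1"
proof -
  obtain S0 where S0: "S0 \<in> P" "h \<in> S0"
    using P h by (auto simp: partition_on_def universal_vertex_def)
  have "adjacent_parts G P h = P - {S0}"
  proof
    show "adjacent_parts G P h \<subseteq> P - {S0}" using S0 by (auto simp: adjacent_parts_def)
    show "P - {S0} \<subseteq> adjacent_parts G P h"
    proof
      fix S assume S: "S \<in> P - {S0}"
      then have "h \<notin> S" using S0 P by (auto simp: partition_on_def disjoint_def)
      moreover obtain x where "x \<in> S"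
        using S P by (metis DiffD1 ex_in_conv partition_onD3)
      moreover have "x \<in> pverts G" using S \<open>x \<in> S\<close> P by (auto simp: partition_on_def)
      ultimately show "S \<in> adjacent_parts G P h"
        using S h by (auto simp: adjacent_parts_def universal_vertex_def)
    qed
  qed
  then show ?thesis using S0 by simp
qed

lemma (in pair_graph) universal_vertex_unique_if_resolving:
  assumes R: "resolving_multiset_partition G P"
    and h: "universal_vertex G h" and h': "universal_vertex G h'"
  shows "h = h'"
proof (rule inj_onD[OF inj_on_card_adjacent_parts[OF h R]])
  have P: "partition_on (pverts G) P"
    using R by (simp add: resolving_multiset_partition_def)
  show "card (adjacent_parts G P h) = card (adjacent_parts G P h')"
    using card_adjacent_parts_universal_vertex[OF h P]
      card_adjacent_parts_universal_vertex[OF h' P] by simp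
qed (use h h' in \<open>simp_all add: universal_vertex_def\<close>)

text \<open>Choosing a point of \<open>N\<close> in each member of \<open>A\<close> is injective,
  because the members are disjoint. It serves below with \<open>N\<close> a set containing all
  neighbours of a rim vertex, and with \<open>N\<close> the whole rim.\<close>

lemma card_disjoint_le_card_transversal:
  assumes "disjoint A" and "finite N" and "\<And>S. S \<in> A \<Longrightarrow> S \<inter> N \<noteq> {}"
  shows "card A \<le> card N"
proof -
  have "\<forall>S\<in>A. \<exists>x. x \<in> S \<inter> N" using assms(3) by blast
  then obtain f where f: "\<And>S. S \<in> A \<Longrightarrow> f S \<in> S \<inter> N" by metis
  have "inj_on f A"
    using f assms(1) by (intro inj_onI) (metis IntD1 disjointD disjoint_iff)
  then show ?thesis using f assms(2) by (intro card_inj_on_le[of f]) auto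
qed

section \<open>The fan\<close>

lemma universal_vertex_fan_Hub: "universal_vertex (fan n k) Hub"
  by (auto simp: universal_vertex_def pverts_fan parcs_fan)

text \<open>Removing the edge between \<open>k\<close> and \<open>k + 1\<close> from the rim
  triangle leaves a path whose middle vertex is \<open>k + 2\<close> modulo 3.\<close>

lemma universal_vertex_fan_3:
  assumes "k < 3"
  shows "universal_vertex (fan 3 k) (Rim (Suc (Suc k) mod 3))"
proof -
  have V: "pverts (fan 3 k') = {Hub, Rim 0, Rim 1, Rim 2}" for k'
    by (auto simp: pverts_fan less_Suc_eq numeral_3_eq_3 numeral_2_eq_2)
  consider "k = 0" | "k = 1" | "k = 2" using assms by linarith
  then show ?thesis
    by cases (simp_all add: universal_vertex_def V insert_Diff_if parcs_fan numeral_2_eq_2)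
qed

lemma card_adjacent_parts_Rim_le:
  assumes n: "n \<ge> 3" and P: "partition_on (pverts (fan n k)) P" and i: "i < n"
  shows "card (adjacent_parts (fan n k) P (Rim i)) \<le> 3"
proof -
  \<comment> \<open>The hub with the cyclic successor and predecessor of \<open>i\<close>. The
    removed edge is ignored, as only an upper bound on the neighbourhood is wanted. The case
    \<open>i = 0\<close> is the wrap-around.\<close>
  define N where "N = {Hub, Rim (Suc i mod n), Rim (if i = 0 then n - 1 else i - 1)}"
  have N: "x \<in> N" if "(Rim i, x) \<in> parcs (fan n k)" for x
    using that i by (auto simp: parcs_fan N_def mod_Suc split: if_splits)
  have "card (adjacent_parts (fan n k) P (Rim i)) \<le> card N"
  proof (rule card_disjoint_le_card_transversal)
    show "disjoint (adjacent_parts (fan n k) P (Rim i))"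
      using P by (auto simp: partition_on_def disjoint_def adjacent_parts_def)
    show "finite N" by (simp add: N_def)
  qed (use N in \<open>auto simp: adjacent_parts_def\<close>)
  also have "\<dots> \<le> 3" by (simp add: N_def card_insert_if)
  finally show ?thesis .
qed

text \<open>\<open>Rim i\<close> is adjacent to the hub, so it must share the part of the hub. Hence
  no part is \<open>{Hub}\<close> alone, and every part meets the rim.\<close>

lemma card_le_if_adjacent_parts_Rim_empty:
  assumes P: "partition_on (pverts (fan n k)) P" and i: "i < n"
    and empty: "adjacent_parts (fan n k) P (Rim i) = {}"
  shows "card P \<le> n"
proof -
  obtain S0 where S0: "S0 \<in> P" "Hub \<in> S0" using P by (auto simp: partition_on_def pverts_fan)
  have "(Rim i, Hub) \<in> parcs (fan n k)" using i by (simp add: parcs_fan)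
  then have RS0: "Rim i \<in> S0" using S0 empty by (auto simp: adjacent_parts_def)
  have "card P \<le> card (Rim ` {..<n})"
  proof (rule card_disjoint_le_card_transversal)
    show "disjoint P" using P by (simp add: partition_on_def)
  next
    fix S assume S: "S \<in> P"
    show "S \<inter> Rim ` {..<n} \<noteq> {}"
    proof (cases "S = S0")
      case True
      then show ?thesis using RS0 i by auto
    next
      case False
      then have "Hub \<notin> S" using S S0 P by (auto simp: partition_on_def disjoint_def)
      moreover have "S \<subseteq> insert Hub (Rim ` {..<n})" "S \<noteq> {}"
        using S P by (auto simp: partition_on_def pverts_fan)
      ultimately show ?thesis by auto
    qed
  qed simp
  also have "\<dots> = n" by (simp add: card_image inj_on_def)
  finally show ?thesis .
qed

lemma not_resolving_multiset_partition_fan: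
  assumes n: "n \<ge> 3" and k: "k < n"
  shows "\<not> resolving_multiset_partition (fan n k) P"
proof
  assume R: "resolving_multiset_partition (fan n k) P"
  then have P: "partition_on (pverts (fan n k)) P"
    by (simp add: resolving_multiset_partition_def)
  interpret pair_graph "fan n k" using n by (rule pair_graph_fan)
  define f where "f v = card (adjacent_parts (fan n k) P v)" for v
  have inj: "inj_on f (insert Hub (Rim ` {..<n}))"
    using inj_on_card_adjacent_parts[OF universal_vertex_fan_Hub R]
    by (simp add: f_def[abs_def] pverts_fan)
  have rim: "f ` Rim ` {..<n} \<subseteq> {..3}"
    using card_adjacent_parts_Rim_le[OF n P] by (auto simp: f_def)
  have card_rim: "card (f ` Rim ` {..<n}) = n"
    using inj by (subst card_image) (auto intro: inj_on_subset simp: card_image inj_on_def)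
  have "n \<le> 4" using card_mono[OF _ rim] card_rim by simp
  then consider "n = 3" | "n = 4" using n by linarith
  then show False
  proof cases
    case 1
    then show False
      using universal_vertex_unique_if_resolving[OF R universal_vertex_fan_Hub]
        universal_vertex_fan_3 k by blast
  next
    case 2
    \<comment> \<open>Four distinct values in a set of four elements exhaust it.\<close>
    have "f ` Rim ` {..<n} = {..3}"
      using rim card_rim 2 by (intro card_subset_eq) auto
    then have "0 \<in> f ` Rim ` {..<n}" by simp
    then obtain i where i: "i < n" "f (Rim i) = 0" by auto
    \<comment> \<open>Since \<open>card\<close> is also 0 on infinite sets, finiteness lets
      \<open>f (Rim i) = 0\<close> be read as emptiness.\<close>
    have "finite (adjacent_parts (fan n k) P (Rim i))"
      using finite_elements[OF pair_finite_verts P] by (simp add: adjacent_parts_def)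
    then have "card P \<le> n"
      using i card_le_if_adjacent_parts_Rim_empty[OF P] by (simp add: f_def)
    \<comment> \<open>Here \<open>f Hub\<close> is \<open>card P - 1\<close>, so the hub too takes
      one of the four values already used on the rim.\<close>
    then have "f Hub \<le> 3"
      using 2 card_adjacent_parts_universal_vertex[OF universal_vertex_fan_Hub P]
      by (simp add: f_def)
    then have "f ` insert Hub (Rim ` {..<n}) \<subseteq> {..3}" using rim by auto
    then have "card (f ` insert Hub (Rim ` {..<n})) \<le> 4"
      using card_mono[of "{..3::nat}"] by simp
    moreover have "card (insert Hub (Rim ` {..<n})) = Suc n"
      by (subst card_insert_disjoint) (auto simp: card_image inj_on_def)
    ultimately show False using card_image[OF inj] 2 by linarith
  qed
qed

theorem theorem4p4:
  fixes n k :: nat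
  assumes "n \<ge> 3" and "k < n"
  shows "mpd (fan n k) = \<infinity>"
  using not_resolving_multiset_partition_fan[OF assms] by (simp add: mpd_def top_enat_def)

end
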